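(* Let $\hat\gamma\in C^2(2\pi\mathbb{T})$ be positive with $3\hat\gamma(\theta)-\hat\gamma(\theta-\pi)\ge0$ for all $\theta\in2\pi\mathbb{T}$, let $c=\inf_{\theta\in2\pi\mathbb{T}}[3\hat\gamma(\theta)-\hat\gamma(\theta-\pi)]$, and let $\alpha\in\mathbb{R}$. If $c=0$, then $k_0^\alpha(\theta)$ exists (i.e. $k_0^\alpha(\theta)<+\infty$ for all $\theta\in2\pi\mathbb{T}$) if and only if one of the following conditions holds: (1) $\alpha=-1$; (2) $\hat\gamma'(\theta^* )=0$ whenever $\theta^*\in2\pi\mathbb{T}$ satisfies $3\hat\gamma(\theta^* )=\hat\gamma(\theta^*-\pi)$.
   Context: $2\pi\mathbb{T}=\mathbb{R}/2\pi\mathbb{Z}$. For $\alpha,a\in\mathbb{R}$ and $\phi,\theta\in2\pi\mathbb{T}$ define $$P_{\alpha,a}(\phi,\theta)=\hat\gamma(\theta)+\frac{\alpha-1}{2}\hat\gamma'(\theta)\sin2\phi+a\sin^2\phi,$$ $$Q_\alpha(\phi,\theta)=\hat\gamma(\theta-\phi)+\hat\gamma(\theta)\cos\phi+\alpha\hat\gamma'(\theta)\sin\phi,$$ and $$k_0^\alpha(\theta)=\inf\bigl\{a\ge0\;:\;4\hat\gamma(\theta)P_{\alpha,a}(\phi,\theta)\ge Q_\alpha^2(\phi,\theta)\ \ \forall\phi\in2\pi\mathbb{T}\bigr\},$$ with the convention $\inf\emptyset=+\infty$. *)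

theory Defs
  imports "HOL-Analysis.Analysis"
begin

text \<open>
  Functions on the circle of length \<open>2 * pi\<close> are represented by their \<open>2 * pi\<close>-periodic lifts to
  \<^typ>\<open>real\<close>; points of the circle are represented by arbitrary real representatives, and the
  derivative on the circle is the ordinary derivative of the lift.
\<close>

definition C2_circle :: "(real \<Rightarrow> real) \<Rightarrow> bool" where
  "C2_circle \<gamma> \<longleftrightarrow>
     (\<forall>\<theta>. \<gamma> (\<theta> + 2 * pi) = \<gamma> \<theta>) \<and>
     (\<forall>\<theta>. \<gamma> differentiable (at \<theta>)) \<and>
     (\<forall>\<theta>. deriv \<gamma> differentiable (at \<theta>)) \<and>
     continuous_on UNIV (deriv (deriv \<gamma>))"

definition P_fun :: "(real \<Rightarrow> real) \<Rightarrow> real \<Rightarrow> real \<Rightarrow> real \<Rightarrow> real \<Rightarrow> real" where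
  "P_fun \<gamma> \<alpha> a \<phi> \<theta> =
     \<gamma> \<theta> + (\<alpha> - 1) / 2 * deriv \<gamma> \<theta> * sin (2 * \<phi>) + a * (sin \<phi>)\<^sup>2"

definition Q_fun :: "(real \<Rightarrow> real) \<Rightarrow> real \<Rightarrow> real \<Rightarrow> real \<Rightarrow> real" where
  "Q_fun \<gamma> \<alpha> \<phi> \<theta> = \<gamma> (\<theta> - \<phi>) + \<gamma> \<theta> * cos \<phi> + \<alpha> * deriv \<gamma> \<theta> * sin \<phi>"

text \<open>
  The infimum is taken in the extended reals, so that it is \<open>\<infinity>\<close> when no real \<open>a\<close> is admissible.
\<close>

definition k0 :: "(real \<Rightarrow> real) \<Rightarrow> real \<Rightarrow> real \<Rightarrow> ereal" where
  "k0 \<gamma> \<alpha> \<theta> =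
     Inf (ereal ` {a. a \<ge> 0 \<and> (\<forall>\<phi>. 4 * \<gamma> \<theta> * P_fun \<gamma> \<alpha> a \<phi> \<theta> \<ge> (Q_fun \<gamma> \<alpha> \<phi> \<theta>)\<^sup>2)})"

end

theory Submission
  imports Defs "HOL-Library.Periodic_Fun"
begin

text \<open>
  Fix \<open>\<theta>\<close> and write \<open>F \<phi> = 4 \<gamma>(\<theta>) P\<^bsub>\<alpha>,0\<^esub>(\<phi>,\<theta>) - Q\<^bsub>\<alpha>\<^esub>(\<phi>,\<theta>)\<^sup>2\<close>. The parameter \<open>a\<close> enters the
  inequality only through the penalty \<open>4 \<gamma>(\<theta>) a sin\<^sup>2 \<phi>\<close>, so \<open>k\<^sub>0(\<theta>)\<close> is finite iff adding some
  nonnegative multiple of \<open>sin\<^sup>2\<close> makes the periodic, twice differentiable function \<open>F\<close> nonnegative. The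
  penalty has no effect at \<open>0\<close> and \<open>\<pi>\<close>, where it has a nondegenerate quadratic zero, and it can
  be made as large as needed elsewhere. Hence the only obstruction sits at these two points:
  there \<open>F\<close> must be positive, or vanish together with its derivative
  (lemma \<open>sin_squared_penalty_iff\<close>).

  At \<open>\<phi> = 0\<close> both \<open>F\<close> and \<open>F'\<close> vanish for every \<open>\<theta>\<close>. At \<open>\<phi> = \<pi>\<close>,
  \<open>F(\<pi>) = (3\<gamma>(\<theta>) - \<gamma>(\<theta>-\<pi>)) (\<gamma>(\<theta>) + \<gamma>(\<theta>-\<pi>))\<close>, which is positive unless \<open>\<theta>\<close> is a contact
  point, that is, \<open>3\<gamma>(\<theta>) = \<gamma>(\<theta>-\<pi>)\<close>. A contact point minimises the nonnegative function
  \<open>3\<gamma> - \<gamma>(\<cdot>-\<pi>)\<close>, so \<open>\<gamma>'(\<theta>-\<pi>) = 3\<gamma>'(\<theta>)\<close> there, and \<open>F'(\<pi>)\<close> becomes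
  \<open>8 (\<alpha>+1) \<gamma>(\<theta>) \<gamma>'(\<theta>)\<close>. It vanishes exactly when \<open>\<alpha> = -1\<close> or \<open>\<gamma>'(\<theta>) = 0\<close>.
\<close>

section \<open>Making a periodic function nonnegative by a multiple of the squared sine\<close>

lemma second_derivative_test_local_min:
  fixes G G' :: "real \<Rightarrow> real"
  assumes G: "\<And>y. (G has_real_derivative G' y) (at y)"
    and G': "(G' has_real_derivative D) (at x)"
    and crit: "G' x = 0" and D: "D > 0"
  shows "\<exists>e>0. \<forall>y. \<bar>y - x\<bar> < e \<longrightarrow> G x \<le> G y"
proof -
  obtain r where r: "r > 0" "\<And>h. 0 < h \<Longrightarrow> h < r \<Longrightarrow> 0 < G' (x + h)"
    using DERIV_pos_inc_right[OF G' D] crit by auto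
  obtain l where l: "l > 0" "\<And>h. 0 < h \<Longrightarrow> h < l \<Longrightarrow> G' (x - h) < 0"
    using DERIV_pos_inc_left[OF G' D] crit by auto
  have right: "G' z \<ge> 0" if "x \<le> z" "z < x + r" for z
    using r(2)[of "z - x"] that crit by (cases "z = x") auto
  have left: "G' z \<le> 0" if "z \<le> x" "x - l < z" for z
    using l(2)[of "x - z"] that crit by (cases "z = x") auto
  have "G x \<le> G y" if y: "\<bar>y - x\<bar> < min l r" for y
  proof (cases "x \<le> y")
    case True
    show ?thesis
      by (rule DERIV_nonneg_imp_nondecreasing[OF True]) (use G right y in \<open>force\<close>)
  next
    case False
    then have "y \<le> x" by simp
    then show ?thesis
      by (rule DERIV_nonpos_imp_nonincreasing) (use G left y in \<open>force\<close>)
  qed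
  then show ?thesis using r(1) l(1) by (intro exI[of _ "min l r"]) auto
qed

text \<open>
  For a large multiple \<open>a\<close> the function \<open>F + a sin\<^sup>2\<close> is positive at \<open>x\<close> if \<open>sin x \<noteq> 0\<close>, and has
  second derivative \<open>F'' + 2 a > 0\<close> at a double zero \<open>x\<close> of \<open>F\<close> where \<open>sin x = 0\<close>. So the
  inequality holds near every point, with \<open>a\<close> depending on the point.
\<close>

lemma sin_squared_penalty_local:
  fixes F F' :: "real \<Rightarrow> real"
  assumes F: "\<And>y. (F has_real_derivative F' y) (at y)"
    and F': "F' differentiable (at x)"
    and zero: "sin x = 0 \<Longrightarrow> F x > 0 \<or> F x = 0 \<and> F' x = 0"
  shows "\<exists>a\<ge>0. \<exists>e>0. \<forall>y. \<bar>y - x\<bar> < e \<longrightarrow> F y + a * (sin y)\<^sup>2 \<ge> 0"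
proof (cases "sin x = 0 \<and> F x = 0")
  case False
  define a where "a = (if sin x = 0 then 0 else (\<bar>F x\<bar> + 1) / (sin x)\<^sup>2)"
  have a: "a \<ge> 0" by (simp add: a_def)
  have pos: "F x + a * (sin x)\<^sup>2 > 0"
    using False zero by (auto simp: a_def)
  have "continuous (at x) (\<lambda>y. F y + a * (sin y)\<^sup>2)"
    using DERIV_isCont[OF F] by (intro continuous_intros) auto
  then have "\<forall>\<^sub>F y in at x. F y + a * (sin y)\<^sup>2 > 0"
    using pos by (auto simp: continuous_at dest: order_tendstoD)
  then obtain e where "e > 0" and e: "\<And>y. y \<noteq> x \<Longrightarrow> dist y x < e \<Longrightarrow> F y + a * (sin y)\<^sup>2 > 0"
    by (auto simp: eventually_at)
  have "F y + a * (sin y)\<^sup>2 \<ge> 0" if "\<bar>y - x\<bar> < e" for y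
    using e[of y] pos that by (cases "y = x") (auto simp: dist_real_def)
  with a \<open>e > 0\<close> show ?thesis by blast
next
  case True
  then have x: "sin x = 0" "F x = 0" "F' x = 0" using zero by auto
  then have cos: "(cos x)\<^sup>2 = 1" using sin_cos_squared_add[of x] by simp
  obtain D where D: "(F' has_real_derivative D) (at x)"
    using F' by (auto simp: real_differentiable_def)
  define a where "a = \<bar>D\<bar> + 1"
  have "((\<lambda>y. F y + a * (sin y)\<^sup>2) has_real_derivative F' y + 2 * a * sin y * cos y) (at y)" for y
    by (auto intro!: derivative_eq_intros F)
  moreover have "((\<lambda>y. F' y + 2 * a * sin y * cos y) has_real_derivative D + 2 * a) (at x)"
    using x cos by (auto intro!: derivative_eq_intros D simp: power2_eq_square)
  moreover have "D + 2 * a > 0" by (simp add: a_def)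
  ultimately obtain e where "e > 0"
    "\<And>y. \<bar>y - x\<bar> < e \<Longrightarrow> F x + a * (sin x)\<^sup>2 \<le> F y + a * (sin y)\<^sup>2"
    using second_derivative_test_local_min
      [of "\<lambda>y. F y + a * (sin y)\<^sup>2" "\<lambda>y. F' y + 2 * a * sin y * cos y" "D + 2 * a" x] x
    by auto
  then show ?thesis using x by (intro exI[of _ a]) (auto simp: a_def)
qed

text \<open>
  Compactness of one period makes the multiple uniform, since enlarging \<open>a\<close> keeps the inequality.
  Conversely, at a zero of \<open>sin\<close> the inequality reads \<open>F \<ge> 0\<close>, and if \<open>F\<close> vanishes there, then
  \<open>F + a sin\<^sup>2\<close> has a minimum, at which its derivative equals that of \<open>F\<close>.
\<close>

lemma sin_squared_penalty_iff:
  fixes F F' :: "real \<Rightarrow> real"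
  assumes per: "\<And>y. F (y + 2 * pi) = F y"
    and F: "\<And>y. (F has_real_derivative F' y) (at y)"
    and F': "\<And>y. F' differentiable (at y)"
  shows "(\<exists>a\<ge>0. \<forall>y. F y + a * (sin y)\<^sup>2 \<ge> 0) \<longleftrightarrow>
    (\<forall>x\<in>{0, pi}. F x > 0 \<or> F x = 0 \<and> F' x = 0)"
proof
  assume "\<exists>a\<ge>0. \<forall>y. F y + a * (sin y)\<^sup>2 \<ge> 0"
  then obtain a where a: "\<And>y. F y + a * (sin y)\<^sup>2 \<ge> 0" by blast
  have "F' x = 0" if x: "sin x = 0" "F x = 0" for x
  proof -
    have "((\<lambda>y. F y + a * (sin y)\<^sup>2) has_real_derivative F' x) (at x)"
      using x by (auto intro!: derivative_eq_intros F)
    then show ?thesis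
      by (rule DERIV_local_min[where d = 1]) (use a x in auto)
  qed
  moreover have "F x \<ge> 0" if "sin x = 0" for x using a[of x] that by simp
  ultimately show "\<forall>x\<in>{0, pi}. F x > 0 \<or> F x = 0 \<and> F' x = 0"
    by (metis insertE less_eq_real_def sin_pi sin_zero singletonD)
next
  assume zero: "\<forall>x\<in>{0, pi}. F x > 0 \<or> F x = 0 \<and> F' x = 0"
  \<comment> \<open>This period contains both zeros of the sine in its interior, so that the boundary needs no care.\<close>
  define I where "I = {-(pi/2)..3*pi/2}"
  have sin_I: "x \<in> {0, pi}" if "x \<in> I" "sin x = 0" for x
  proof (cases "x < pi")
    case True
    then have "-pi < x" using that pi_gt_zero unfolding I_def atLeastAtMost_iff by linarith
    then show ?thesis using True that sin_eq_0_pi[of x] by auto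
  next
    case False
    have "-pi < x - pi" "x - pi < pi" using that False pi_gt_zero unfolding I_def atLeastAtMost_iff by linarith+
    then show ?thesis using that sin_eq_0_pi[of "x - pi"] by (auto simp: sin_diff)
  qed
  have "\<exists>a e. a \<ge> 0 \<and> e > 0 \<and> (\<forall>y. \<bar>y - x\<bar> < e \<longrightarrow> F y + a * (sin y)\<^sup>2 \<ge> 0)" if "x \<in> I" for x
    using sin_squared_penalty_local[OF F F', of x] zero sin_I[OF that] by blast
  then obtain a e where a: "\<And>x. x \<in> I \<Longrightarrow> a x \<ge> 0" and e: "\<And>x. x \<in> I \<Longrightarrow> e x > 0"
    and ae: "\<And>x y. x \<in> I \<Longrightarrow> \<bar>y - x\<bar> < e x \<Longrightarrow> F y + a x * (sin y)\<^sup>2 \<ge> 0"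
    by metis
  have "compact I" by (simp add: I_def)
  moreover have "I \<subseteq> (\<Union>x\<in>I. ball x (e x))" using e by force
  ultimately obtain J where J: "J \<subseteq> I" "finite J" "I \<subseteq> (\<Union>x\<in>J. ball x (e x))"
    by (auto elim: compactE_image[where f = "\<lambda>x. ball x (e x)" and C = I])
  \<comment> \<open>The sum dominates every local constant and is nonnegative without a case distinction.\<close>
  define A where "A = (\<Sum>x\<in>J. a x)"
  have A: "A \<ge> 0" using J a by (auto simp: A_def intro: sum_nonneg)
  have on_I: "F y + A * (sin y)\<^sup>2 \<ge> 0" if "y \<in> I" for y
  proof -
    obtain x where x: "x \<in> J" "\<bar>y - x\<bar> < e x"
      using J(3) \<open>y \<in> I\<close> by (auto simp: dist_real_def abs_minus_commute)
    have "a x \<le> A" unfolding A_def using x J a by (intro member_le_sum) auto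
    then have "a x * (sin y)\<^sup>2 \<le> A * (sin y)\<^sup>2" by (simp add: mult_right_mono)
    moreover have "F y + a x * (sin y)\<^sup>2 \<ge> 0" using ae x J(1) by auto
    ultimately show ?thesis by linarith
  qed
  interpret F: periodic_fun_simple F "2 * pi" by standard (rule per)
  interpret S: periodic_fun_simple "sin :: real \<Rightarrow> real" "2 * pi"
    by standard (rule sin_periodic)
  have "F y + A * (sin y)\<^sup>2 \<ge> 0" for y
  proof -
    define k where "k = \<lfloor>(y + pi/2) / (2 * pi)\<rfloor>"
    define z where "z = y - of_int k * (2 * pi)"
    have "of_int k \<le> (y + pi/2) / (2 * pi)" "(y + pi/2) / (2 * pi) \<le> of_int k + 1"
      unfolding k_def by linarith+
    then have "of_int k * (2 * pi) \<le> y + pi/2" "y + pi/2 \<le> (of_int k + 1) * (2 * pi)"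
      by (simp_all add: pos_le_divide_eq pos_divide_le_eq)
    then have "z \<in> I" by (simp add: z_def I_def algebra_simps)
    then show ?thesis
      using on_I[of z] F.minus_of_int[of y k] S.minus_of_int[of y k] by (simp add: z_def)
  qed
  with A show "\<exists>a\<ge>0. \<forall>y. F y + a * (sin y)\<^sup>2 \<ge> 0" by blast
qed

section \<open>Finiteness at a single angle\<close>

lemma C2_circle_has_derivs:
  assumes "C2_circle \<gamma>"
  shows "(\<gamma> has_real_derivative deriv \<gamma> x) (at x)"
    and "(deriv \<gamma> has_real_derivative deriv (deriv \<gamma>) x) (at x)"
  using assms by (auto simp: C2_circle_def DERIV_deriv_iff_real_differentiable)

text \<open>
  The factor \<open>4 \<gamma>(\<theta>)\<close> in front of \<open>a\<close> is a positive constant and is absorbed into the penalty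
  multiple. The identities \<open>F(0) = F'(0) = 0\<close> leave only the condition at \<open>\<pi>\<close>; the two
  disjuncts below are \<open>F(\<pi>) > 0\<close> and \<open>F(\<pi>) = F'(\<pi>) = 0\<close>.
\<close>

lemma k0_finite_iff:
  assumes C2: "C2_circle \<gamma>" and pos: "\<And>x. \<gamma> x > 0"
  shows "k0 \<gamma> \<alpha> \<theta> < \<infinity> \<longleftrightarrow>
    3 * \<gamma> \<theta> > \<gamma> (\<theta> - pi) \<or>
    3 * \<gamma> \<theta> = \<gamma> (\<theta> - pi) \<and> (2 * \<alpha> - 1) * deriv \<gamma> \<theta> + deriv \<gamma> (\<theta> - pi) = 0"
proof -
  define F where "F \<phi> = 4 * \<gamma> \<theta> * P_fun \<gamma> \<alpha> 0 \<phi> \<theta> - (Q_fun \<gamma> \<alpha> \<phi> \<theta>)\<^sup>2" for \<phi>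
  define Q' where "Q' \<phi> = - deriv \<gamma> (\<theta> - \<phi>) - \<gamma> \<theta> * sin \<phi> + \<alpha> * deriv \<gamma> \<theta> * cos \<phi>" for \<phi>
  define F' where "F' \<phi> = 4 * \<gamma> \<theta> * (\<alpha> - 1) * deriv \<gamma> \<theta> * cos (2 * \<phi>)
    - 2 * Q_fun \<gamma> \<alpha> \<phi> \<theta> * Q' \<phi>" for \<phi>
  note [derivative_intros] = DERIV_chain2[OF C2_circle_has_derivs(1)[OF C2]]
    DERIV_chain2[OF C2_circle_has_derivs(2)[OF C2]]
  have dQ: "((\<lambda>\<phi>. Q_fun \<gamma> \<alpha> \<phi> \<theta>) has_real_derivative Q' \<phi>) (at \<phi>)" for \<phi>
    unfolding Q_fun_def Q'_def by (auto intro!: derivative_eq_intros)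
  have dQ': "\<exists>D. (Q' has_real_derivative D) (at \<phi>)" for \<phi>
    unfolding Q'_def by (rule exI) (rule derivative_eq_intros refl)+
  have dF: "(F has_real_derivative F' \<phi>) (at \<phi>)" for \<phi>
    unfolding F_def P_fun_def F'_def by (auto intro!: derivative_eq_intros dQ)
  have dF': "F' differentiable (at \<phi>)" for \<phi>
  proof -
    obtain D where D: "(Q' has_real_derivative D) (at \<phi>)" using dQ' by blast
    have "\<exists>E. (F' has_real_derivative E) (at \<phi>)"
      unfolding F'_def by (rule exI) (rule derivative_eq_intros dQ D refl)+
    then show ?thesis by (simp add: real_differentiable_def)
  qed
  have per: "F (\<phi> + 2 * pi) = F \<phi>" for \<phi>
  proof -
    have "\<gamma> (\<theta> - \<phi>) = \<gamma> (\<theta> - (\<phi> + 2 * pi))"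
      using C2 unfolding C2_circle_def by (metis add_diff_cancel_right' diff_add_eq diff_diff_eq)
    moreover have "sin (2 * (\<phi> + 2 * pi)) = sin (2 * \<phi>)"
      using sin_periodic[of "2 * \<phi>"] sin_periodic[of "2 * \<phi> + 2 * pi"] by (simp add: algebra_simps)
    ultimately show ?thesis by (simp add: F_def P_fun_def Q_fun_def)
  qed
  have F0: "F 0 = 0" "F' 0 = 0"
    by (simp_all add: F_def F'_def Q'_def P_fun_def Q_fun_def power2_eq_square algebra_simps)
  have Fpi: "F pi = (3 * \<gamma> \<theta> - \<gamma> (\<theta> - pi)) * (\<gamma> \<theta> + \<gamma> (\<theta> - pi))"
    by (simp add: F_def P_fun_def Q_fun_def power2_eq_square algebra_simps)
  have F'pi: "F' pi = 4 * \<gamma> \<theta> * ((2 * \<alpha> - 1) * deriv \<gamma> \<theta> + deriv \<gamma> (\<theta> - pi))"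
    if "3 * \<gamma> \<theta> = \<gamma> (\<theta> - pi)"
    by (simp add: F'_def Q'_def Q_fun_def flip: that) (simp add: algebra_simps)
  have sum_pos: "\<gamma> \<theta> + \<gamma> (\<theta> - pi) > 0" using pos by (simp add: add_pos_pos)
  have admissible: "4 * \<gamma> \<theta> * P_fun \<gamma> \<alpha> a \<phi> \<theta> \<ge> (Q_fun \<gamma> \<alpha> \<phi> \<theta>)\<^sup>2 \<longleftrightarrow>
    F \<phi> + (4 * \<gamma> \<theta> * a) * (sin \<phi>)\<^sup>2 \<ge> 0" for a \<phi>
    by (simp add: F_def P_fun_def algebra_simps)
  have "k0 \<gamma> \<alpha> \<theta> < \<infinity> \<longleftrightarrow> (\<exists>a\<ge>0. \<forall>\<phi>. F \<phi> + (4 * \<gamma> \<theta> * a) * (sin \<phi>)\<^sup>2 \<ge> 0)"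
    unfolding k0_def admissible Inf_less_iff by auto
  also have "\<dots> \<longleftrightarrow> (\<exists>b\<ge>0. \<forall>\<phi>. F \<phi> + b * (sin \<phi>)\<^sup>2 \<ge> 0)"
  proof
    assume "\<exists>b\<ge>0. \<forall>\<phi>. F \<phi> + b * (sin \<phi>)\<^sup>2 \<ge> 0"
    then obtain b where "b \<ge> 0" "\<forall>\<phi>. F \<phi> + b * (sin \<phi>)\<^sup>2 \<ge> 0" by blast
    then show "\<exists>a\<ge>0. \<forall>\<phi>. F \<phi> + (4 * \<gamma> \<theta> * a) * (sin \<phi>)\<^sup>2 \<ge> 0"
      using pos[of \<theta>] by (intro exI[of _ "b / (4 * \<gamma> \<theta>)"]) auto
  next
    assume "\<exists>a\<ge>0. \<forall>\<phi>. F \<phi> + (4 * \<gamma> \<theta> * a) * (sin \<phi>)\<^sup>2 \<ge> 0"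
    then obtain a where "a \<ge> 0" "\<forall>\<phi>. F \<phi> + (4 * \<gamma> \<theta> * a) * (sin \<phi>)\<^sup>2 \<ge> 0" by blast
    then show "\<exists>b\<ge>0. \<forall>\<phi>. F \<phi> + b * (sin \<phi>)\<^sup>2 \<ge> 0"
      using pos[of \<theta>] by (intro exI[of _ "4 * \<gamma> \<theta> * a"]) auto
  qed
  also have "\<dots> \<longleftrightarrow> F pi > 0 \<or> F pi = 0 \<and> F' pi = 0"
    using sin_squared_penalty_iff[OF per dF dF'] F0 by simp
  also have "\<dots> \<longleftrightarrow> 3 * \<gamma> \<theta> > \<gamma> (\<theta> - pi) \<or>
    3 * \<gamma> \<theta> = \<gamma> (\<theta> - pi) \<and> (2 * \<alpha> - 1) * deriv \<gamma> \<theta> + deriv \<gamma> (\<theta> - pi) = 0"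
    using sum_pos F'pi pos[of \<theta>] by (auto simp: Fpi zero_less_mult_iff)
  finally show ?thesis .
qed

section \<open>Contact points\<close>

text \<open>A contact point is a global minimum of the nonnegative function \<open>3\<gamma> - \<gamma>(\<cdot>-\<pi>)\<close>.\<close>

lemma deriv_at_contact_point:
  assumes C2: "C2_circle \<gamma>" and nonneg: "\<And>x. 3 * \<gamma> x - \<gamma> (x - pi) \<ge> 0"
    and contact: "3 * \<gamma> \<theta> = \<gamma> (\<theta> - pi)"
  shows "deriv \<gamma> (\<theta> - pi) = 3 * deriv \<gamma> \<theta>"
proof -
  have "((\<lambda>x. 3 * \<gamma> x - \<gamma> (x - pi)) has_real_derivative 3 * deriv \<gamma> \<theta> - deriv \<gamma> (\<theta> - pi)) (at \<theta>)"
    by (auto intro!: derivative_eq_intros DERIV_chain2[OF C2_circle_has_derivs(1)[OF C2]])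
  then have "3 * deriv \<gamma> \<theta> - deriv \<gamma> (\<theta> - pi) = 0"
    by (rule DERIV_local_min[where d = 1]) (use nonneg contact in auto)
  then show ?thesis by simp
qed

theorem theorem4p5:
  fixes \<gamma> :: "real \<Rightarrow> real" and c \<alpha> :: real
  assumes "C2_circle \<gamma>"
    and "\<And>\<theta>. \<gamma> \<theta> > 0"
    and "\<And>\<theta>. 3 * \<gamma> \<theta> - \<gamma> (\<theta> - pi) \<ge> 0"
    and "c = (INF \<theta>. 3 * \<gamma> \<theta> - \<gamma> (\<theta> - pi))"
    and "c = 0"
  shows "(\<forall>\<theta>. k0 \<gamma> \<alpha> \<theta> < \<infinity>) \<longleftrightarrow>
    (\<alpha> = -1 \<or> (\<forall>\<theta>'. 3 * \<gamma> \<theta>' = \<gamma> (\<theta>' - pi) \<longrightarrow> deriv \<gamma> \<theta>' = 0))"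
proof -
  have "k0 \<gamma> \<alpha> \<theta> < \<infinity> \<longleftrightarrow> (3 * \<gamma> \<theta> = \<gamma> (\<theta> - pi) \<longrightarrow> \<alpha> = -1 \<or> deriv \<gamma> \<theta> = 0)" for \<theta>
  proof (cases "3 * \<gamma> \<theta> = \<gamma> (\<theta> - pi)")
    case True
    have "(2 * \<alpha> - 1) * deriv \<gamma> \<theta> + deriv \<gamma> (\<theta> - pi) = 2 * (\<alpha> + 1) * deriv \<gamma> \<theta>"
      using deriv_at_contact_point[OF assms(1,3) True] by (simp add: algebra_simps)
    then show ?thesis
      using True k0_finite_iff[OF assms(1,2), of \<alpha> \<theta>] by (auto simp: add_eq_0_iff2)
  next
    case False
    then show ?thesis
      using assms(3)[of \<theta>] k0_finite_iff[OF assms(1,2), of \<alpha> \<theta>] by simp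
  qed
  then show ?thesis by blast
qed

end
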